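(* Let $d\ge1$, let $\Delta$ be a $d$-dimensional orientable pseudomanifold without boundary with $s=f_d(\Delta)$ facets, and let $G$ be the facet-ridge graph of $\Delta$. Then (1) $\mathcal{P}_\Delta$ is unimodularly equivalent to the symmetric edge polytope $\mathcal{P}_{C_s}$ of the cycle graph $C_s$ on $s$ vertices, and (2) $\mathcal{P}^\Delta$ is unimodularly equivalent to the symmetric edge polytope $\mathcal{P}_G$.
   Context: For $j\ge1$ the boundary map $\partial_j$ of a simplicial complex on $[n]$ sends $\{i_1<\dots<i_{j+1}\}$ to $\sum_k(-1)^{k+1}(\sigma\setminus\{i_k\})$, identified with its integer matrix. For $d=\dim\Delta$: $\mathcal{P}_\Delta=\operatorname{conv}$ of the columns of $\partial_d$ and $-\partial_d$; $\mathcal{P}^\Delta=\operatorname{conv}$ of the columns of $\partial_d^\top$ and $-\partial_d^\top$. For a graph $G$, the symmetric edge polytope is $\mathcal{P}_G=\operatorname{conv}$ of the columns of $\partial_1$ and $-\partial_1$, where $\partial_1$ is the (directed) incidence matrix of $G$ viewed as a 1-dimensional complex. A $d$-pseudomanifold is a pure complex where each $(d-1)$-face lies in at most two facets and that is strongly connected via $(d-1)$-faces; it is without boundary if every $(d-1)$-face lies in exactly two facets, and then orientable if $H_d(\Delta;\mathbb{Z})\cong\mathbb{Z}$. The facet-ridge graph has the facets as vertices, two facets adjacent iff they share a $(d-1)$-face. Polytopes $P,Q$ are unimodularly equivalent if, after possibly embedding them in a common space by adding coordinates, $P=UQ$ for an integer matrix $U$ with $|\det U|=1$. *)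

theory Defs
  imports
    "HOL-Analysis.Convex"
    "HOL-Analysis.Finite_Function_Topology"
    "HOL-Algebra.Free_Abelian_Groups"
    "HOL-Library.List_Lexorder"
    "Jordan_Normal_Form.Determinant"
begin

section \<open>Simplicial complexes\<close>

text \<open>Not every point of \<open>{1..n}\<close> is required to be a vertex.\<close>

definition simplicial_complex :: "nat \<Rightarrow> nat set set \<Rightarrow> bool" where
  "simplicial_complex n \<Delta> \<longleftrightarrow>
     \<Delta> \<noteq> {} \<and> \<Delta> \<subseteq> Pow {1..n} \<and> (\<forall>\<sigma>\<in>\<Delta>. \<forall>\<tau>. \<tau> \<subseteq> \<sigma> \<longrightarrow> \<tau> \<in> \<Delta>)"

text \<open>Dimensions are integers, so that the empty face has dimension \<open>-1\<close>.\<close>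

definition face_dim :: "nat set \<Rightarrow> int" where
  "face_dim \<sigma> = int (card \<sigma>) - 1"

definition complex_dim :: "nat set set \<Rightarrow> int" where
  "complex_dim \<Delta> = Max (face_dim ` \<Delta>)"

definition faces :: "nat set set \<Rightarrow> int \<Rightarrow> nat set set" where
  "faces \<Delta> j = {\<sigma> \<in> \<Delta>. face_dim \<sigma> = j}"

definition facets :: "nat set set \<Rightarrow> nat set set" where
  "facets \<Delta> = {F \<in> \<Delta>. \<forall>\<sigma>\<in>\<Delta>. F \<subseteq> \<sigma> \<longrightarrow> \<sigma> = F}"

definition pure :: "nat set set \<Rightarrow> bool" where
  "pure \<Delta> \<longleftrightarrow> (\<forall>F\<in>facets \<Delta>. face_dim F = complex_dim \<Delta>)"

section \<open>Boundary maps and homology\<close>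

text \<open>The elements of \<open>\<sigma>\<close> are numbered from \<open>0\<close> here, hence the sign \<open>(-1)^k\<close>
  where a numbering from \<open>1\<close> gives \<open>(-1)^(k+1)\<close>. Only simplices of dimension at least \<open>1\<close>
  matter: on vertices this is the augmentation, with value a multiple of the empty face.\<close>

definition simplex_boundary :: "nat set \<Rightarrow> nat set \<Rightarrow>\<^sub>0 int" where
  "simplex_boundary \<sigma> =
     (\<Sum>k<card \<sigma>. frag_cmul ((-1) ^ k) (frag_of (\<sigma> - {sorted_list_of_set \<sigma> ! k})))"

definition simplicial_chain_group :: "nat set set \<Rightarrow> int \<Rightarrow> (nat set \<Rightarrow>\<^sub>0 int) monoid" where
  "simplicial_chain_group \<Delta> j = free_Abelian_group (faces \<Delta> j)"

definition simplicial_cycles :: "nat set set \<Rightarrow> int \<Rightarrow> (nat set \<Rightarrow>\<^sub>0 int) set" where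
  "simplicial_cycles \<Delta> j =
     kernel (simplicial_chain_group \<Delta> j) (simplicial_chain_group \<Delta> (j - 1))
       (frag_extend simplex_boundary)"

definition simplicial_boundaries :: "nat set set \<Rightarrow> int \<Rightarrow> (nat set \<Rightarrow>\<^sub>0 int) set" where
  "simplicial_boundaries \<Delta> j =
     frag_extend simplex_boundary ` carrier (simplicial_chain_group \<Delta> (j + 1))"

text \<open>For \<open>j = 0\<close> this would be the reduced group; it is used for \<open>j \<ge> 1\<close> only.\<close>

definition simplicial_homology :: "nat set set \<Rightarrow> int \<Rightarrow> (nat set \<Rightarrow>\<^sub>0 int) set monoid" where
  "simplicial_homology \<Delta> j =
     subgroup_generated (simplicial_chain_group \<Delta> j) (simplicial_cycles \<Delta> j)
       Mod simplicial_boundaries \<Delta> j"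

text \<open>To write the boundary map as a matrix, the faces of each dimension are listed in
  lexicographic order.\<close>

definition face_list :: "nat set set \<Rightarrow> int \<Rightarrow> nat set list" where
  "face_list \<Delta> j = map set (sorted_list_of_set (sorted_list_of_set ` faces \<Delta> j))"

definition boundary_mat :: "nat set set \<Rightarrow> int \<Rightarrow> int mat" where
  "boundary_mat \<Delta> j =
     mat (length (face_list \<Delta> (j - 1))) (length (face_list \<Delta> j))
       (\<lambda>(a, b). Poly_Mapping.lookup (simplex_boundary (face_list \<Delta> j ! b)) (face_list \<Delta> (j - 1) ! a))"

section \<open>Pseudomanifolds\<close>

definition share_ridge :: "nat set set \<Rightarrow> nat set \<Rightarrow> nat set \<Rightarrow> bool" where
  "share_ridge \<Delta> F F' \<longleftrightarrow> F \<in> facets \<Delta> \<and> F' \<in> facets \<Delta> \<and> F \<noteq> F' \<and>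
     (\<exists>\<tau>\<in>faces \<Delta> (complex_dim \<Delta> - 1). \<tau> \<subseteq> F \<and> \<tau> \<subseteq> F')"

definition pseudomanifold :: "int \<Rightarrow> nat set set \<Rightarrow> bool" where
  "pseudomanifold d \<Delta> \<longleftrightarrow>
     complex_dim \<Delta> = d \<and> pure \<Delta> \<and>
     (\<forall>\<tau>\<in>faces \<Delta> (d - 1). card {F \<in> facets \<Delta>. \<tau> \<subseteq> F} \<le> 2) \<and>
     (\<forall>F\<in>facets \<Delta>. \<forall>F'\<in>facets \<Delta>. (share_ridge \<Delta>)\<^sup>*\<^sup>* F F')"

definition without_boundary :: "nat set set \<Rightarrow> bool" where
  "without_boundary \<Delta> \<longleftrightarrow>
     (\<forall>\<tau>\<in>faces \<Delta> (complex_dim \<Delta> - 1). card {F \<in> facets \<Delta>. \<tau> \<subseteq> F} = 2)"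

definition orientable :: "nat set set \<Rightarrow> bool" where
  "orientable \<Delta> \<longleftrightarrow> simplicial_homology \<Delta> (complex_dim \<Delta>) \<cong> integer_group"

section \<open>Polytopes\<close>

text \<open>Every \<open>\<real>\<^sup>N\<close> is regarded as the space of those finitely supported real sequences
  (type \<open>nat \<Rightarrow>\<^sub>0 real\<close>) that vanish from index \<open>N\<close> on. Adding zero coordinates to a
  polytope is then the identity.\<close>

definition coord_space :: "nat \<Rightarrow> (nat \<Rightarrow>\<^sub>0 real) set" where
  "coord_space N = {x. Poly_Mapping.keys x \<subseteq> {..<N}}"

definition point_of_vec :: "real vec \<Rightarrow> nat \<Rightarrow>\<^sub>0 real" where
  "point_of_vec v = (\<Sum>i<dim_vec v. Poly_Mapping.single i (vec_index v i))"

definition mat_apply :: "int mat \<Rightarrow> (nat \<Rightarrow>\<^sub>0 real) \<Rightarrow> nat \<Rightarrow>\<^sub>0 real" where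
  "mat_apply U x =
     point_of_vec (map_mat real_of_int U *\<^sub>v vec (dim_col U) (Poly_Mapping.lookup x))"

definition unimodularly_equivalent ::
    "(nat \<Rightarrow>\<^sub>0 real) set \<Rightarrow> (nat \<Rightarrow>\<^sub>0 real) set \<Rightarrow> bool" where
  "unimodularly_equivalent P Q \<longleftrightarrow>
     (\<exists>N U. U \<in> carrier_mat N N \<and> \<bar>Determinant.det U\<bar> = 1 \<and>
        P \<subseteq> coord_space N \<and> Q \<subseteq> coord_space N \<and> P = mat_apply U ` Q)"

definition mat_columns :: "int mat \<Rightarrow> (nat \<Rightarrow>\<^sub>0 real) set" where
  "mat_columns M = point_of_vec ` set (cols (map_mat real_of_int M))"

definition symmetric_polytope :: "int mat \<Rightarrow> (nat \<Rightarrow>\<^sub>0 real) set" where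
  "symmetric_polytope M = convex hull (mat_columns M \<union> mat_columns (- M))"

text \<open>The polytopes written with \<open>\<Delta>\<close> as a lower and as an upper index.\<close>

definition lower_polytope :: "nat set set \<Rightarrow> (nat \<Rightarrow>\<^sub>0 real) set" where
  "lower_polytope \<Delta> = symmetric_polytope (boundary_mat \<Delta> (complex_dim \<Delta>))"

definition upper_polytope :: "nat set set \<Rightarrow> (nat \<Rightarrow>\<^sub>0 real) set" where
  "upper_polytope \<Delta> = symmetric_polytope (transpose_mat (boundary_mat \<Delta> (complex_dim \<Delta>)))"

section \<open>Graphs\<close>

text \<open>A finite simple graph is a pair of a vertex set and a set of two-element edges. Viewing
  it as a simplicial complex requires natural numbers as vertices; other graphs have to be
  relabelled first.\<close>

type_synonym 'a sgraph = "'a set \<times> 'a set set"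

definition relabel :: "('a \<Rightarrow> 'b) \<Rightarrow> 'a sgraph \<Rightarrow> 'b sgraph" where
  "relabel \<phi> G = (\<phi> ` fst G, (\<lambda>e. \<phi> ` e) ` snd G)"

definition graph_complex :: "nat sgraph \<Rightarrow> nat set set" where
  "graph_complex G = {{}} \<union> (\<lambda>v. {v}) ` fst G \<union> snd G"

definition symmetric_edge_polytope :: "nat sgraph \<Rightarrow> (nat \<Rightarrow>\<^sub>0 real) set" where
  "symmetric_edge_polytope G = symmetric_polytope (boundary_mat (graph_complex G) 1)"

text \<open>A simple graph, hence meaningful, only for \<open>s \<ge> 3\<close>.\<close>

definition cycle_graph :: "nat \<Rightarrow> nat sgraph" where
  "cycle_graph s = ({1..s}, insert {s, 1} {{i, i + 1} | i. 1 \<le> i \<and> i < s})"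

definition facet_ridge_graph :: "nat set set \<Rightarrow> nat set sgraph" where
  "facet_ridge_graph \<Delta> = (facets \<Delta>, {{F, F'} | F F'. share_ridge \<Delta> F F'})"

end

theory Submission
  imports Defs
begin

text \<open>Two integer matrices whose rows span the same lattice have unimodularly equivalent symmetric
  polytopes. Orientability supplies signs \<open>\<epsilon>\<close> on the facets making \<open>\<Sum>F. \<epsilon> F * F\<close> a cycle;
  rescaling the columns of the top boundary matrix by them turns each row into the difference of two
  unit vectors, because a ridge lies in exactly two facets. The rows are then the edge vectors of the
  facet-ridge graph, which is the second claim. As this graph is connected, they span all
  integer vectors of coordinate sum zero. The rows of the boundary matrix of a cycle of length \<open>s\<close>
  span the same lattice, which gives the first claim.\<close>

section \<open>Symmetric polytopes and row lattices\<close>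

text \<open>The generating points are columns, so an integer matrix acting on the space multiplies
  from the left and only recombines rows; this is why the row lattice decides. The obstacle is that
  the transition matrices between two spanning sets of rows need be neither square nor invertible.
  It is removed by working in the sum of the two row spaces, where they become blocks of one matrix
  of determinant 1 or -1. The two claims use the signs \<open>\<epsilon>\<close> differently. In the
  first they rescale columns, which a polytope symmetric about the origin cannot detect, and any two
  connected graphs on equally many columns give the same lattice. For the cycle graph the columns
  are its edges and the rows its vertices, each vertex joining two edges. In the second claim the
  matrix is transposed: \<open>\<epsilon>\<close> rescales rows, which is a change of coordinates,
  and one leftover sign per ridge is absorbed by the symmetry.\<close>

lemma lookup_scaleR: "Poly_Mapping.lookup (c *\<^sub>R x) i = c * Poly_Mapping.lookup (x :: nat \<Rightarrow>\<^sub>0 real) i"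
proof -
  have "finite {i. c *\<^sub>R Poly_Mapping.lookup x i \<noteq> 0}"
    using finite_subset[OF _ finite_keys[of x]] by (force simp: in_keys_iff)
  thus ?thesis
    by (simp add: scaleR_poly_mapping_def lookup_Abs_poly_mapping)
qed

lemma lookup_point_of_vec:
  "Poly_Mapping.lookup (point_of_vec v) i = (if i < dim_vec v then vec_index v i else 0)"
  by (simp add: point_of_vec_def lookup_sum lookup_single when_def)

lemma lookup_mat_apply:
  "Poly_Mapping.lookup (mat_apply U x) i =
     (if i < dim_row U then \<Sum>j<dim_col U. real_of_int (U $$ (i, j)) * Poly_Mapping.lookup x j else 0)"
  by (simp add: mat_apply_def lookup_point_of_vec scalar_prod_def lessThan_atLeast0)

lemma linear_mat_apply: "linear (mat_apply U)"
  by (rule linearI; rule poly_mapping_eqI)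
    (simp_all add: lookup_mat_apply lookup_add lookup_scaleR distrib_left sum.distrib sum_distrib_left mult.left_commute)

definition column_point :: "int mat \<Rightarrow> nat \<Rightarrow> nat \<Rightarrow>\<^sub>0 real" where
  "column_point M j = point_of_vec (col (map_mat real_of_int M) j)"

lemma lookup_column_point:
  "j < dim_col M \<Longrightarrow> Poly_Mapping.lookup (column_point M j) i =
     (if i < dim_row M then real_of_int (M $$ (i, j)) else 0)"
  by (simp add: column_point_def lookup_point_of_vec)

lemma symmetric_polytope_eq:
  "symmetric_polytope M = convex hull (\<Union>j<dim_col M. {column_point M j, - column_point M j})"
proof -
  have "mat_columns M = column_point M ` {..<dim_col M}" for M
    by (simp add: mat_columns_def column_point_def cols_def image_image lessThan_atLeast0)
  moreover have "column_point (- M) j = - column_point M j" if "j < dim_col M" for j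
    using that by (intro poly_mapping_eqI) (simp add: lookup_column_point)
  ultimately show ?thesis
    unfolding symmetric_polytope_def by (intro arg_cong[of _ _ "\<lambda>X. convex hull X"]) auto
qed

text \<open>The generators come in pairs of opposite points, so permuting columns and changing their
  signs leaves the hull alone. All signs and all orderings of columns are absorbed here.\<close>

lemma symmetric_polytope_cong:
  assumes "bij_betw \<pi> {..<dim_col A} {..<dim_col B}"
    and "\<And>j. j < dim_col A \<Longrightarrow> column_point A j \<in> {column_point B (\<pi> j), - column_point B (\<pi> j)}"
  shows "symmetric_polytope A = symmetric_polytope B"
proof -
  have "(\<Union>j<dim_col A. {column_point A j, - column_point A j}) =
      (\<Union>j<dim_col A. {column_point B (\<pi> j), - column_point B (\<pi> j)})"
    using assms(2) by (intro SUP_cong refl) fastforce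
  also have "\<dots> = (\<Union>j\<in>\<pi> ` {..<dim_col A}. {column_point B j, - column_point B j})"
    by blast
  finally show ?thesis
    using assms(1) by (simp only: symmetric_polytope_eq bij_betw_imp_surj_on)
qed

lemma mat_apply_symmetric_polytope:
  assumes "U \<in> carrier_mat m k" and "M \<in> carrier_mat k l"
  shows "mat_apply U ` symmetric_polytope M = symmetric_polytope (U * M)"
proof -
  have "mat_apply U (column_point M j) = column_point (U * M) j" if "j < l" for j
    using assms that
    by (intro poly_mapping_eqI)
      (auto simp: lookup_mat_apply lookup_column_point scalar_prod_def lessThan_atLeast0 intro!: sum.cong)
  moreover have "mat_apply U (- x) = - mat_apply U x" for x
    by (rule linear_neg[OF linear_mat_apply])
  moreover have "mat_apply U ` symmetric_polytope M =
      convex hull (mat_apply U ` (\<Union>j<dim_col M. {column_point M j, - column_point M j}))"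
    by (simp add: symmetric_polytope_eq convex_hull_linear_image[OF linear_mat_apply])
  ultimately show ?thesis
    using assms unfolding symmetric_polytope_eq
    by (auto simp: image_UN intro!: arg_cong[of _ _ "\<lambda>X. convex hull X"])
qed

lemma symmetric_polytope_subset_coord_space:
  assumes "dim_row M \<le> N"
  shows "symmetric_polytope M \<subseteq> coord_space N"
proof -
  have eq: "coord_space N = {x. \<forall>i\<ge>N. Poly_Mapping.lookup x i = 0}"
    by (auto simp: coord_space_def in_keys_iff not_less[symmetric])
  have "convex (coord_space N)"
    unfolding eq by (auto simp: convex_def lookup_add lookup_scaleR)
  moreover have "{column_point M j, - column_point M j} \<subseteq> coord_space N" if "j < dim_col M" for j
    using that assms unfolding eq by (auto simp: lookup_column_point)
  ultimately show ?thesis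
    unfolding symmetric_polytope_eq by (intro hull_minimal) auto
qed

text \<open>Points are finitely supported sequences, so padding changes no point. This places the
  columns of a matrix in the larger dimension that the block matrix below requires.\<close>

lemma symmetric_polytope_append_zero_rows:
  assumes "M \<in> carrier_mat k l"
  shows "symmetric_polytope (M @\<^sub>r 0\<^sub>m m l) = symmetric_polytope M"
proof (rule symmetric_polytope_cong[where \<pi> = id])
  show "bij_betw id {..<dim_col (M @\<^sub>r 0\<^sub>m m l)} {..<dim_col M}"
    using assms by (simp add: append_rows_def)
  show "column_point (M @\<^sub>r 0\<^sub>m m l) j \<in> {column_point M (id j), - column_point M (id j)}"
    if "j < dim_col (M @\<^sub>r 0\<^sub>m m l)" for j
    using that assms
    by (intro insertI1 poly_mapping_eqI iffD2[OF insert_iff] disjI1)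
      (auto simp: lookup_column_point append_rows_def)
qed

text \<open>The block matrix \<open>[X, 1; 1 - Y X, -Y]\<close> is the product of the two shears
  \<open>(x, y) \<mapsto> (x, y + X x)\<close> and \<open>(x, y) \<mapsto> (x - Y y, y)\<close> followed by the swap of the two blocks. It
  carries \<open>(B z, 0)\<close> to \<open>(A z, B z - Y A z) = (A z, 0)\<close>.\<close>

lemma unimodularly_equivalent_symmetric_polytope:
  assumes A: "A \<in> carrier_mat r s" and B: "B \<in> carrier_mat t s"
    and X: "X \<in> carrier_mat r t" and Y: "Y \<in> carrier_mat t r"
    and AX: "A = X * B" and BY: "B = Y * A"
  shows "unimodularly_equivalent (symmetric_polytope A) (symmetric_polytope B)"
proof -
  define U where "U = four_block_mat X (1\<^sub>m r) (1\<^sub>m t - Y * X) (- Y)"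
  \<comment> \<open>\<open>V\<close> is \<open>U\<close> with the roles of \<open>X\<close> and
    \<open>Y\<close> exchanged. It is an integer right inverse of \<open>U\<close>, so both
    determinants are units of the integers.\<close>
  define V where "V = four_block_mat Y (1\<^sub>m t) (1\<^sub>m r - X * Y) (- X)"
  note c = A B X Y
  have XY: "X * Y \<in> carrier_mat r r" and YX: "Y * X \<in> carrier_mat t t"
    using c by auto
  have UC: "U \<in> carrier_mat (t + r) (t + r)"
    using c unfolding U_def by (auto simp: add.commute)
  have VC: "V \<in> carrier_mat (t + r) (t + r)"
    using c unfolding V_def by (auto simp: add.commute)
  have "U * V = four_block_mat (X * Y + 1\<^sub>m r * (1\<^sub>m r - X * Y)) (X * 1\<^sub>m t + 1\<^sub>m r * - X)
     ((1\<^sub>m t - Y * X) * Y + - Y * (1\<^sub>m r - X * Y)) ((1\<^sub>m t - Y * X) * 1\<^sub>m t + - Y * - X)"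
    unfolding U_def V_def using c by (intro mult_four_block_mat) auto
  also have "X * Y + 1\<^sub>m r * (1\<^sub>m r - X * Y) = 1\<^sub>m r"
  proof -
    have "P + 1\<^sub>m r * (1\<^sub>m r - P) = 1\<^sub>m r" if "P \<in> carrier_mat r r" for P :: "int mat"
      using that by (subst left_mult_one_mat[of _ r r]) auto
    thus ?thesis
      using XY .
  qed
  also have "X * 1\<^sub>m t + 1\<^sub>m r * - X = 0\<^sub>m r t"
    using c by auto
  also have "(1\<^sub>m t - Y * X) * Y + - Y * (1\<^sub>m r - X * Y) = 0\<^sub>m t r"
  proof -
    have "(1\<^sub>m t - Y * X) * Y = Y - Y * X * Y"
      using c YX by (simp add: minus_mult_distrib_mat[of _ t t])
    moreover have "Y * (1\<^sub>m r - X * Y) = Y - Y * X * Y"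
      using c XY by (simp add: mult_minus_distrib_mat[OF Y one_carrier_mat XY])
    moreover have "- Y * (1\<^sub>m r - X * Y) = - (Y * (1\<^sub>m r - X * Y))"
      using c by (intro uminus_mult_left_mat) auto
    moreover have "Q + - Q = 0\<^sub>m t r" if "Q \<in> carrier_mat t r" for Q :: "int mat"
      using that by (intro eq_matI) auto
    moreover have "Y - Y * X * Y \<in> carrier_mat t r"
      using c YX by (intro minus_carrier_mat) auto
    ultimately show ?thesis
      by metis
  qed
  also have "(1\<^sub>m t - Y * X) * 1\<^sub>m t + - Y * - X = 1\<^sub>m t"
    using c YX by (subst right_mult_one_mat[of _ t t]) (auto simp: uminus_mult_left_mat)
  finally have "U * V = 1\<^sub>m (t + r)"
    by (simp add: add.commute)
  hence "det U * det V = 1"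
    using det_mult[OF UC VC] by simp
  hence "\<bar>det U\<bar> = 1"
    using zmult_eq_1_iff by fastforce
  \<comment> \<open>Appending rows is a four-block matrix whose right-hand blocks have width 0, so
    the product rule for blocks applies. The lower block of the product vanishes because
    \<open>Y * (X * B) = Y * A = B\<close>.\<close>
  have "U * (B @\<^sub>r 0\<^sub>m r s) = four_block_mat (X * B + 1\<^sub>m r * 0\<^sub>m r s) (X * 0\<^sub>m t 0 + 1\<^sub>m r * 0\<^sub>m r 0)
     ((1\<^sub>m t - Y * X) * B + - Y * 0\<^sub>m r s) ((1\<^sub>m t - Y * X) * 0\<^sub>m t 0 + - Y * 0\<^sub>m r 0)"
    unfolding U_def append_rows_def using c
    by (subst mult_four_block_mat[of _ r t _ r _ t _ _ s _ 0]) auto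
  also have "\<dots> = A @\<^sub>r 0\<^sub>m t s"
  proof -
    have "(1\<^sub>m t - Y * X) * B = B - Y * (X * B)"
      using c by (simp add: minus_mult_distrib_mat[of _ t t] assoc_mult_mat[of Y t r X t B s])
    also have "\<dots> = 0\<^sub>m t s"
      unfolding AX[symmetric] BY[symmetric] using B by auto
    finally show ?thesis
      unfolding append_rows_def AX[symmetric] using c by auto
  qed
  finally have "mat_apply U ` symmetric_polytope B = symmetric_polytope A"
    using mat_apply_symmetric_polytope[of U "t + r" "t + r" "B @\<^sub>r 0\<^sub>m r s" s] A B UC
    by (simp add: symmetric_polytope_append_zero_rows)
  thus ?thesis
    unfolding unimodularly_equivalent_def using UC \<open>\<bar>det U\<bar> = 1\<close> c
    by (intro exI[of _ "t + r"] exI[of _ U]) (auto intro!: symmetric_polytope_subset_coord_space[THEN subsetD])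
qed

section \<open>Matrices with labelled rows and columns\<close>

definition list_mat :: "'r list \<Rightarrow> 'c list \<Rightarrow> ('r \<Rightarrow> 'c \<Rightarrow> int) \<Rightarrow> int mat" where
  "list_mat R C f = mat (length R) (length C) (\<lambda>(i, j). f (R ! i) (C ! j))"

lemma list_mat_cong:
  "(\<And>r c. r \<in> set R \<Longrightarrow> c \<in> set C \<Longrightarrow> f r c = g r c) \<Longrightarrow> list_mat R C f = list_mat R C g"
  unfolding list_mat_def by (intro cong_mat) auto

lemma list_mat_carrier [simp]: "list_mat R C f \<in> carrier_mat (length R) (length C)"
  by (simp add: list_mat_def)

lemma transpose_list_mat: "transpose_mat (list_mat R C f) = list_mat C R (\<lambda>c r. f r c)"
  by (auto simp: list_mat_def)

lemma list_mat_times: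
  assumes "distinct T"
  shows "list_mat R T x * list_mat T C f = list_mat R C (\<lambda>r c. \<Sum>t\<in>set T. x r t * f t c)"
proof (rule eq_matI)
  fix i j assume "i < dim_row (list_mat R C (\<lambda>r c. \<Sum>t\<in>set T. x r t * f t c))"
    "j < dim_col (list_mat R C (\<lambda>r c. \<Sum>t\<in>set T. x r t * f t c))"
  hence ij: "i < length R" "j < length C" by (simp_all add: list_mat_def)
  have "(\<Sum>t\<in>set T. x (R ! i) t * f t (C ! j)) = (\<Sum>k<length T. x (R ! i) (T ! k) * f (T ! k) (C ! j))"
    using assms by (intro sum.reindex_bij_betw[symmetric] bij_betw_nth) auto
  with ij show "(list_mat R T x * list_mat T C f) $$ (i, j) = list_mat R C (\<lambda>r c. \<Sum>t\<in>set T. x r t * f t c) $$ (i, j)"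
    by (simp add: list_mat_def scalar_prod_def lessThan_atLeast0)
qed (simp_all add: list_mat_def)

text \<open>The last two assumptions put the rows of each matrix in the integer span of the rows of
  the other, once columns are matched by \<open>\<pi>\<close> and rescaled by
  \<open>\<delta>\<close>. Their coefficients form the two transition matrices; \<open>\<pi>\<close>
  and \<open>\<delta>\<close> do not affect the polytopes.\<close>

lemma unimodularly_equivalent_list_mat:
  assumes R: "distinct R" and R': "distinct R'" and C: "distinct C" and C': "distinct C'"
    and \<pi>: "bij_betw \<pi> (set C) (set C')"
    and \<delta>: "\<And>c. c \<in> set C \<Longrightarrow> \<delta> c \<in> {-1, 1}"
    and X: "\<And>r. r \<in> set R \<Longrightarrow> \<exists>x. \<forall>c\<in>set C. \<delta> c * f r c = (\<Sum>t\<in>set R'. x t * g t (\<pi> c))"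
    and Y: "\<And>t. t \<in> set R' \<Longrightarrow> \<exists>y. \<forall>c\<in>set C. g t (\<pi> c) = (\<Sum>r\<in>set R. y r * (\<delta> c * f r c))"
  shows "unimodularly_equivalent (symmetric_polytope (list_mat R C f)) (symmetric_polytope (list_mat R' C' g))"
proof -
  obtain x where x: "\<And>r c. r \<in> set R \<Longrightarrow> c \<in> set C \<Longrightarrow> \<delta> c * f r c = (\<Sum>t\<in>set R'. x r t * g t (\<pi> c))"
    using X by metis
  obtain y where y: "\<And>t c. t \<in> set R' \<Longrightarrow> c \<in> set C \<Longrightarrow> g t (\<pi> c) = (\<Sum>r\<in>set R. y t r * (\<delta> c * f r c))"
    using Y by metis
  let ?A = "list_mat R C (\<lambda>r c. \<delta> c * f r c)" and ?B = "list_mat R' C (\<lambda>t c. g t (\<pi> c))"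
  have eqs: "?A = list_mat R R' x * ?B" "?B = list_mat R' R y * ?A"
    unfolding list_mat_times[OF R] list_mat_times[OF R'] using x y by (blast intro: list_mat_cong)+
  have "unimodularly_equivalent (symmetric_polytope ?A) (symmetric_polytope ?B)"
    using list_mat_carrier list_mat_carrier list_mat_carrier list_mat_carrier eqs
    by (rule unimodularly_equivalent_symmetric_polytope)
  also have "symmetric_polytope ?A = symmetric_polytope (list_mat R C f)"
  proof (rule symmetric_polytope_cong[where \<pi> = id])
    fix j assume "j < dim_col ?A"
    hence j: "j < length C" by (simp add: list_mat_def)
    hence "\<delta> (C ! j) = 1 \<or> \<delta> (C ! j) = -1" using \<delta>[of "C ! j"] by auto
    thus "column_point ?A j \<in> {column_point (list_mat R C f) (id j), - column_point (list_mat R C f) (id j)}"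
    proof
      assume "\<delta> (C ! j) = 1"
      hence "column_point ?A j = column_point (list_mat R C f) j"
        using j by (intro poly_mapping_eqI) (simp add: lookup_column_point list_mat_def)
      thus ?thesis by simp
    next
      assume "\<delta> (C ! j) = -1"
      hence "column_point ?A j = - column_point (list_mat R C f) j"
        using j by (intro poly_mapping_eqI) (simp add: lookup_column_point list_mat_def)
      thus ?thesis by simp
    qed
  qed (simp add: list_mat_def)
  also have "symmetric_polytope ?B = symmetric_polytope (list_mat R' C' g)"
  proof -
    have bC: "bij_betw ((!) C) {..<length C} (set C)" and bC': "bij_betw ((!) C') {..<length C'} (set C')"
      using C C' by (auto intro: bij_betw_nth)
    \<comment> \<open>The position in \<open>C'\<close> of the column that \<open>\<pi>\<close>
      assigns to the column at position \<open>j\<close> of \<open>C\<close>.\<close>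
    let ?q = "the_inv_into {..<length C'} ((!) C') \<circ> \<pi> \<circ> (!) C"
    have bij: "bij_betw ?q {..<length C} {..<length C'}"
      using bC \<pi> bij_betw_the_inv_into[OF bC'] by (blast intro: bij_betw_trans)
    have nth: "C' ! ?q j = \<pi> (C ! j)" if "j < length C" for j
      using that \<pi> bC' by (auto simp: bij_betw_def intro!: f_the_inv_into_f[where f = "(!) C'"])
    have "?q j < length C'" if "j < length C" for j
      using bij that by (auto simp: bij_betw_def)
    hence "column_point ?B j = column_point (list_mat R' C' g) (?q j)" if "j < length C" for j
      using that nth[OF that]
      by (intro poly_mapping_eqI) (simp add: lookup_column_point list_mat_def del: comp_apply)
    thus ?thesis
      using bij by (intro symmetric_polytope_cong[where \<pi> = ?q]) (simp_all add: list_mat_def)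
  qed
  finally show ?thesis .
qed

section \<open>Lattices spanned by the edge vectors of connected graphs\<close>

text \<open>Up to the signs \<open>\<epsilon>\<close> of the columns, the rows are the edge vectors \<open>\<plusminus>(e_c - e_c')\<close> of
  a connected graph on \<open>C\<close>.\<close>

definition oriented_incidence :: "'r set \<Rightarrow> 'c set \<Rightarrow> ('r \<Rightarrow> 'c \<Rightarrow> int) \<Rightarrow> ('c \<Rightarrow> int) \<Rightarrow> bool" where
  "oriented_incidence R C f \<epsilon> \<longleftrightarrow>
     finite R \<and> finite C \<and>
     (\<forall>r\<in>R. \<forall>c\<in>C. f r c \<in> {-1, 0, 1}) \<and>
     (\<forall>r\<in>R. card {c\<in>C. f r c \<noteq> 0} = 2) \<and>
     (\<forall>c\<in>C. \<epsilon> c \<in> {-1, 1}) \<and>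
     (\<forall>r\<in>R. (\<Sum>c\<in>C. \<epsilon> c * f r c) = 0) \<and>
     (\<forall>c\<in>C. \<forall>c'\<in>C. (\<lambda>c c'. c \<in> C \<and> c' \<in> C \<and> (\<exists>r\<in>R. f r c \<noteq> 0 \<and> f r c' \<noteq> 0))\<^sup>*\<^sup>* c c')"

text \<open>The row has exactly two nonzero entries and its weighted sum is zero, so the two
  weighted entries cancel.\<close>

lemma oriented_incidence_opposite:
  assumes "oriented_incidence R C f \<epsilon>" and r: "r \<in> R" and c: "c \<in> C" "c' \<in> C" "c \<noteq> c'"
    and nz: "f r c \<noteq> 0" "f r c' \<noteq> 0"
  shows "\<epsilon> c' * f r c' = - (\<epsilon> c * f r c)" and "\<And>a. a \<in> C \<Longrightarrow> f r a \<noteq> 0 \<Longrightarrow> a = c \<or> a = c'"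
proof -
  have fin: "finite C" and "card {c\<in>C. f r c \<noteq> 0} = 2" and sum: "(\<Sum>c\<in>C. \<epsilon> c * f r c) = 0"
    using assms(1) r by (auto simp: oriented_incidence_def)
  moreover have "{c, c'} \<subseteq> {c\<in>C. f r c \<noteq> 0}"
    using c nz by auto
  ultimately have eq: "{c\<in>C. f r c \<noteq> 0} = {c, c'}"
    using c fin by (intro card_subset_eq[symmetric]) auto
  hence "(\<Sum>c\<in>C. \<epsilon> c * f r c) = (\<Sum>c\<in>{c, c'}. \<epsilon> c * f r c)"
    using fin by (intro sum.mono_neutral_right) auto
  thus "\<epsilon> c' * f r c' = - (\<epsilon> c * f r c)"
    using sum c by simp
  show "\<And>a. a \<in> C \<Longrightarrow> f r a \<noteq> 0 \<Longrightarrow> a = c \<or> a = c'"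
    using eq by auto
qed

text \<open>Each row gives a difference of unit vectors for two adjacent columns, and telescoping
  along a path gives the difference for any two columns. With a fixed base column \<open>b\<close>,
  a vector of coordinate sum zero is the combination of the differences \<open>e a - e b\<close>
  with coefficients \<open>g a\<close>.\<close>

lemma oriented_incidence_row_span:
  fixes C :: "'c set"
  assumes o: "oriented_incidence R C f \<epsilon>" and g: "(\<Sum>c\<in>C. g c) = (0::int)"
  shows "\<exists>y. \<forall>c\<in>C. g c = (\<Sum>r\<in>R. y r * (\<epsilon> c * f r c))"
proof -
  define L where "L = {h. \<exists>y. \<forall>c\<in>C. h c = (\<Sum>r\<in>R. y r * (\<epsilon> c * f r c))}"
  have fin: "finite R" "finite C"
    using o by (auto simp: oriented_incidence_def)
  have zero: "(\<lambda>_. 0) \<in> L"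
    unfolding L_def by (auto intro!: exI[of _ "\<lambda>_. 0"])
  have add: "(\<lambda>c. h c + k c) \<in> L" if hk: "h \<in> L" "k \<in> L" for h k
  proof -
    obtain y z where "\<forall>c\<in>C. h c = (\<Sum>r\<in>R. y r * (\<epsilon> c * f r c))" "\<forall>c\<in>C. k c = (\<Sum>r\<in>R. z r * (\<epsilon> c * f r c))"
      using hk unfolding L_def by blast
    thus ?thesis
      unfolding L_def by (auto simp: distrib_right sum.distrib intro!: exI[of _ "\<lambda>r. y r + z r"])
  qed
  have smult: "(\<lambda>c. a * h c) \<in> L" if h: "h \<in> L" for a h
  proof -
    obtain y where "\<forall>c\<in>C. h c = (\<Sum>r\<in>R. y r * (\<epsilon> c * f r c))"
      using h unfolding L_def by blast
    thus ?thesis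
      unfolding L_def by (auto simp: sum_distrib_left mult.assoc intro!: exI[of _ "\<lambda>r. a * y r"])
  qed
  have cong: "k \<in> L" if "h \<in> L" "\<And>c. c \<in> C \<Longrightarrow> h c = k c" for h k
    using that unfolding L_def by auto
  define e where "e = (\<lambda>(a::'c) c. of_bool (c = a) :: int)"
  have edge: "(\<lambda>c. e a c - e b c) \<in> L"
    if ab: "a \<in> C" "b \<in> C" "a \<noteq> b" and r: "r \<in> R" "f r a \<noteq> 0" "f r b \<noteq> 0" for a b r
  proof -
    \<comment> \<open>Indicator coefficients select a single row, so every rescaled row lies in
      \<open>L\<close>.\<close>
    have "(\<Sum>r'\<in>R. (if r' = r then 1 else 0) * h r') = h r" for h :: "_ \<Rightarrow> int"
      using fin r(1) by (simp add: if_distrib[of "\<lambda>x. x * _"] cong: if_cong)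
    hence row: "(\<lambda>c. \<epsilon> c * f r c) \<in> L"
      unfolding L_def by (auto intro!: exI[of _ "\<lambda>r'. if r' = r then 1 else 0"])
    have u: "\<epsilon> a * f r a \<in> {-1, 1}"
      using o ab r unfolding oriented_incidence_def by fastforce
    note opp = oriented_incidence_opposite[OF o r(1) ab r(2,3)]
    \<comment> \<open>Multiplying by the entry at \<open>a\<close>, a sign and hence its own
      inverse, makes that entry 1; by cancellation the entry at \<open>b\<close> becomes -1.\<close>
    show ?thesis
    proof (rule cong[OF smult[OF row, of "\<epsilon> a * f r a"]])
      fix c assume c: "c \<in> C"
      consider "c = a" | "c = b" | "c \<noteq> a" "c \<noteq> b" by blast
      thus "\<epsilon> a * f r a * (\<epsilon> c * f r c) = e a c - e b c"
      proof cases
        case 1 thus ?thesis using u ab by (auto simp: e_def)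
      next
        case 2
        thus ?thesis using u ab opp(1) by (auto simp: e_def)
      next
        case 3
        hence "f r c = 0" using opp(2)[OF c] by auto
        thus ?thesis using 3 by (auto simp: e_def)
      qed
    qed
  qed
  have path: "(\<lambda>c. e a c - e b c) \<in> L" if "a \<in> C" "b \<in> C" for a b
  proof -
    have "(\<lambda>c c'. c \<in> C \<and> c' \<in> C \<and> (\<exists>r\<in>R. f r c \<noteq> 0 \<and> f r c' \<noteq> 0))\<^sup>*\<^sup>* a b"
      using o that unfolding oriented_incidence_def by blast
    thus ?thesis
    proof induction
      case base
      show ?case using zero by simp
    next
      case (step b b')
      have "(\<lambda>c. e b c - e b' c) \<in> L"
      proof (cases "b = b'")
        case True thus ?thesis using zero by simp
      next
        case False thus ?thesis using step.hyps(2) edge by blast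
      qed
      from add[OF step.IH this] show ?case by simp
    qed
  qed
  have "g \<in> L"
  proof (cases "C = {}")
    case True thus ?thesis by (auto simp: L_def)
  next
    case False
    then obtain b where b: "b \<in> C" by blast
    have "(\<lambda>c. \<Sum>a\<in>A. g a * (e a c - e b c)) \<in> L" if "A \<subseteq> C" for A
      using finite_subset[OF that fin(2)] that
      by induction (auto simp: zero intro!: add smult path b)
    from this[of C] show ?thesis
    proof (rule cong)
      fix c assume c: "c \<in> C"
      \<comment> \<open>The surplus at the base column is the total sum of \<open>g\<close>, which
        is zero.\<close>
      have "(\<Sum>a\<in>C. g a * (e a c - e b c)) = (\<Sum>a\<in>C. g a * e a c) - (\<Sum>a\<in>C. g a) * e b c"
        by (simp add: right_diff_distrib sum_subtractf sum_distrib_right)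
      also have "(\<Sum>a\<in>C. g a * e a c) = g c"
        using fin c by (simp add: e_def of_bool_def if_distrib sum.delta cong: if_cong)
      finally show "(\<Sum>a\<in>C. g a * (e a c - e b c)) = g c"
        using g by simp
    qed simp
  qed
  thus ?thesis by (simp add: L_def)
qed

text \<open>Both rescaled row lattices consist of all integer vectors of coordinate sum zero, a
  condition invariant under permuting coordinates. Hence any bijection between the columns
  serves.\<close>

lemma unimodularly_equivalent_oriented_incidence:
  assumes R: "distinct R" "distinct R'" and C: "distinct C" "distinct C'" "length C = length C'"
    and o: "oriented_incidence (set R) (set C) f \<epsilon>" and o': "oriented_incidence (set R') (set C') g \<epsilon>'"
  shows "unimodularly_equivalent (symmetric_polytope (list_mat R C f)) (symmetric_polytope (list_mat R' C' g))"
proof -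
  obtain \<pi> where \<pi>: "bij_betw \<pi> (set C) (set C')"
    using C by (metis List.finite_set distinct_card finite_same_card_bij)
  have \<epsilon>: "\<epsilon> c \<in> {-1, 1}" if "c \<in> set C" for c
    using o that by (simp add: oriented_incidence_def)
  have \<epsilon>': "\<epsilon>' c \<in> {-1, 1}" if "c \<in> set C'" for c
    using o' that by (simp add: oriented_incidence_def)
  have \<epsilon>'\<pi>: "\<epsilon>' (\<pi> c) \<in> {-1, 1}" if "c \<in> set C" for c
    using \<epsilon>' \<pi> that by (auto simp: bij_betw_def)
  \<comment> \<open>The factor \<open>\<epsilon>\<close> brings a row of \<open>f\<close> to
    coordinate sum zero, and \<open>\<epsilon>'\<close> then restores the column signs of
    \<open>g\<close>.\<close>
  show ?thesis
  proof (rule unimodularly_equivalent_list_mat[OF R C(1,2) \<pi>, where \<delta> = "\<lambda>c. \<epsilon> c * \<epsilon>' (\<pi> c)"])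
    show "\<epsilon> c * \<epsilon>' (\<pi> c) \<in> {-1, 1}" if "c \<in> set C" for c
      using \<epsilon>[OF that] \<epsilon>'\<pi>[OF that] by auto
  next
    fix r assume r: "r \<in> set R"
    \<comment> \<open>Row \<open>r\<close>, rescaled to coordinate sum zero and carried to
      \<open>C'\<close> along the inverse of \<open>\<pi>\<close>.\<close>
    let ?h = "\<lambda>c'. \<epsilon> (the_inv_into (set C) \<pi> c') * f r (the_inv_into (set C) \<pi> c')"
    have "(\<Sum>c'\<in>set C'. ?h c') = (\<Sum>c\<in>set C. \<epsilon> c * f r c)"
      using \<pi> by (intro sum.reindex_bij_betw[OF bij_betw_the_inv_into, OF \<pi>, of "\<lambda>c. \<epsilon> c * f r c"])
    hence "(\<Sum>c'\<in>set C'. ?h c') = 0"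
      using o r by (simp add: oriented_incidence_def)
    then obtain y where y: "\<And>c'. c' \<in> set C' \<Longrightarrow> ?h c' = (\<Sum>t\<in>set R'. y t * (\<epsilon>' c' * g t c'))"
      using oriented_incidence_row_span[OF o', of ?h] by blast
    have "\<epsilon> c * \<epsilon>' (\<pi> c) * f r c = (\<Sum>t\<in>set R'. y t * g t (\<pi> c))" if c: "c \<in> set C" for c
    proof -
      have "\<epsilon> c * f r c = (\<Sum>t\<in>set R'. y t * (\<epsilon>' (\<pi> c) * g t (\<pi> c)))"
        using y[of "\<pi> c"] c \<pi> by (auto simp: bij_betw_def the_inv_into_f_f)
      also have "\<dots> = \<epsilon>' (\<pi> c) * (\<Sum>t\<in>set R'. y t * g t (\<pi> c))"
        by (simp add: sum_distrib_left mult.left_commute)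
      finally have "\<epsilon>' (\<pi> c) * (\<epsilon> c * f r c) = \<epsilon>' (\<pi> c) * (\<epsilon>' (\<pi> c) * (\<Sum>t\<in>set R'. y t * g t (\<pi> c)))"
        by simp
      thus ?thesis
        using \<epsilon>'\<pi>[OF c] by auto
    qed
    thus "\<exists>x. \<forall>c\<in>set C. \<epsilon> c * \<epsilon>' (\<pi> c) * f r c = (\<Sum>t\<in>set R'. x t * g t (\<pi> c))"
      by blast
  next
    fix t assume t: "t \<in> set R'"
    have "(\<Sum>c\<in>set C. \<epsilon>' (\<pi> c) * g t (\<pi> c)) = (\<Sum>c'\<in>set C'. \<epsilon>' c' * g t c')"
      by (rule sum.reindex_bij_betw[OF \<pi>])
    hence "(\<Sum>c\<in>set C. \<epsilon>' (\<pi> c) * g t (\<pi> c)) = 0"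
      using o' t by (simp add: oriented_incidence_def)
    then obtain y where y: "\<And>c. c \<in> set C \<Longrightarrow> \<epsilon>' (\<pi> c) * g t (\<pi> c) = (\<Sum>r\<in>set R. y r * (\<epsilon> c * f r c))"
      using oriented_incidence_row_span[OF o, of "\<lambda>c. \<epsilon>' (\<pi> c) * g t (\<pi> c)"] by blast
    have "g t (\<pi> c) = (\<Sum>r\<in>set R. y r * (\<epsilon> c * \<epsilon>' (\<pi> c) * f r c))" if c: "c \<in> set C" for c
    proof -
      have "\<epsilon>' (\<pi> c) * (\<epsilon>' (\<pi> c) * g t (\<pi> c)) = (\<Sum>r\<in>set R. y r * (\<epsilon> c * \<epsilon>' (\<pi> c) * f r c))"
        unfolding y[OF c] by (simp add: sum_distrib_left mult.left_commute mult.assoc)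
      thus ?thesis
        using \<epsilon>'\<pi>[OF c] by auto
    qed
    thus "\<exists>y. \<forall>c\<in>set C. g t (\<pi> c) = (\<Sum>r\<in>set R. y r * (\<epsilon> c * \<epsilon>' (\<pi> c) * f r c))"
      by blast
  qed
qed

section \<open>Simplicial incidence numbers\<close>

abbreviation incidence :: "nat set \<Rightarrow> nat set \<Rightarrow> int" where
  "incidence \<tau> \<sigma> \<equiv> Poly_Mapping.lookup (simplex_boundary \<sigma>) \<tau>"

lemma incidence_eq:
  "incidence \<tau> \<sigma> = (\<Sum>k<card \<sigma>. (-1) ^ k * of_bool (\<sigma> - {sorted_list_of_set \<sigma> ! k} = \<tau>))"
  unfolding simplex_boundary_def lookup_sum
  by (intro sum.cong refl) (simp add: of_bool_def eq_commute)

text \<open>A face with one vertex fewer arises by deleting exactly one vertex, so at most one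
  summand survives, and it is a sign. For ridges the absolute value suffices, as the relation
  between the signs comes from a cycle.\<close>

lemma abs_incidence:
  assumes fin: "finite \<sigma>" and card: "card \<sigma> = Suc (card \<tau>)"
  shows "\<bar>incidence \<tau> \<sigma>\<bar> = of_bool (\<tau> \<subseteq> \<sigma>)"
proof (cases "\<tau> \<subseteq> \<sigma>")
  case True
  have "card (\<sigma> - \<tau>) = 1"
    using fin card True by (simp add: card_Diff_subset finite_subset)
  then obtain x where x: "\<sigma> - \<tau> = {x}"
    by (auto simp: card_1_singleton_iff)
  hence \<tau>: "\<tau> = \<sigma> - {x}" "x \<in> \<sigma>"
    using True by auto
  let ?l = "sorted_list_of_set \<sigma>"
  have l: "set ?l = \<sigma>" "length ?l = card \<sigma>" "distinct ?l"
    using fin by auto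
  obtain k where k: "k < card \<sigma>" "?l ! k = x"
    using \<tau>(2) l by (metis in_set_conv_nth)
  have "(\<sigma> - {?l ! i} = \<tau>) = (i = k)" if i: "i < card \<sigma>" for i
  proof -
    have "?l ! i \<in> \<sigma>" using i l nth_mem by metis
    hence "(\<sigma> - {?l ! i} = \<tau>) = (?l ! i = ?l ! k)"
      unfolding \<tau>(1) k(2) using \<tau>(2) by blast
    thus ?thesis using l i k(1) by (simp add: nth_eq_iff_index_eq)
  qed
  hence "incidence \<tau> \<sigma> = (\<Sum>i<card \<sigma>. if i = k then (-1) ^ k else 0)"
    unfolding incidence_eq by (intro sum.cong) auto
  also have "\<dots> = (-1) ^ k"
    using k by simp
  finally show ?thesis
    using True by (simp add: power_abs)
next
  case False
  hence "\<sigma> - {x} \<noteq> \<tau>" for x by blast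
  thus ?thesis using False by (simp add: incidence_eq)
qed

text \<open>Deleting the smaller endpoint comes first, with sign +1, and leaves the larger one. So
  edges point from the smaller label to the larger.\<close>

lemma incidence_vertex:
  fixes i j v :: nat
  assumes "i < j"
  shows "incidence {v} {i, j} = of_bool (v = j) - of_bool (v = i)"
proof -
  have "sorted_list_of_set (set [i, j]) = [i, j]"
    using assms by (subst sorted_list_of_set_sort_remdups) auto
  thus ?thesis
    using assms by (auto simp: incidence_eq numeral_2_eq_2)
qed

lemma face_list:
  assumes "finite \<Delta>" and "\<forall>\<sigma>\<in>\<Delta>. finite \<sigma>"
  shows "set (face_list \<Delta> j) = faces \<Delta> j" and "distinct (face_list \<Delta> j)"
proof -
  let ?S = "sorted_list_of_set ` faces \<Delta> j"
  have fin: "finite ?S" "\<And>\<sigma>. \<sigma> \<in> faces \<Delta> j \<Longrightarrow> finite \<sigma>"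
    using assms by (auto simp: faces_def)
  show "set (face_list \<Delta> j) = faces \<Delta> j"
    using fin by (force simp: face_list_def)
  have "inj_on set ?S"
    using fin(2) by (auto simp: inj_on_def)
  thus "distinct (face_list \<Delta> j)"
    using fin(1) by (simp add: face_list_def distinct_map)
qed

lemma boundary_mat_eq:
  "boundary_mat \<Delta> j = list_mat (face_list \<Delta> (j - 1)) (face_list \<Delta> j) incidence"
  by (simp add: boundary_mat_def list_mat_def)

lemma graph_complex_faces:
  fixes G :: "nat sgraph"
  assumes "\<forall>e\<in>snd G. card e = 2"
  shows "faces (graph_complex G) 0 = (\<lambda>v. {v}) ` fst G" and "faces (graph_complex G) 1 = snd G"
  using assms by (auto simp: faces_def face_dim_def graph_complex_def)

lemma graph_complex_finite:
  fixes G :: "nat sgraph"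
  assumes "finite (fst G)" and "finite (snd G)" and "\<forall>e\<in>snd G. card e = 2"
  shows "finite (graph_complex G)" and "\<forall>\<sigma>\<in>graph_complex G. finite \<sigma>"
proof -
  show "finite (graph_complex G)" using assms by (simp add: graph_complex_def)
  have "finite e" if "e \<in> snd G" for e
    using assms(3) that card.infinite[of e] by fastforce
  thus "\<forall>\<sigma>\<in>graph_complex G. finite \<sigma>" by (auto simp: graph_complex_def)
qed

section \<open>The cycle graph\<close>

text \<open>\<open>i mod s + 1\<close> is the cyclic successor on \<open>{1..s}\<close>: it sends
  \<open>s\<close> to 1, so the closing edge needs no separate formula.\<close>

definition cycle_edge :: "nat \<Rightarrow> nat \<Rightarrow> nat set" where
  "cycle_edge s i = {i, i mod s + 1}"

lemma bij_betw_cycle_successor: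
  fixes s :: nat
  assumes "s > 0"
  shows "bij_betw (\<lambda>i. i mod s + 1) {1..s} {1..s}"
proof -
  have "inj_on (\<lambda>i. i mod s + 1) {1..s}"
  proof (rule inj_onI)
    fix i j assume ij: "i \<in> {1..s}" "j \<in> {1..s}" "i mod s + 1 = j mod s + 1"
    have "k mod s = (if k = s then 0 else k)" if "k \<in> {1..s}" for k
      using that by auto
    thus "i = j"
      using ij by (auto split: if_splits)
  qed
  moreover have "(\<lambda>i. i mod s + 1) ` {1..s} \<subseteq> {1..s}"
    using assms by (auto simp: Suc_le_eq)
  ultimately show ?thesis
    by (simp add: bij_betw_def endo_inj_surj)
qed

lemma cycle_graph_edges:
  assumes "s > 0"
  shows "snd (cycle_graph s) = cycle_edge s ` {1..s}"
proof -
  have "{1..s} = insert s {1..<s}"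
    using assms by auto
  moreover have "cycle_edge s s = {s, 1}"
    by (simp add: cycle_edge_def)
  moreover have "{{i, i + 1} | i. 1 \<le> i \<and> i < s} = cycle_edge s ` {1..<s}"
    by (force simp: cycle_edge_def)
  ultimately show ?thesis
    by (simp add: cycle_graph_def)
qed

text \<open>For \<open>s = 2\<close> the edges \<open>{1, 2}\<close> and \<open>{2, 1}\<close> would
  coincide, hence the bound.\<close>

lemma inj_on_cycle_edge:
  assumes "s \<ge> 3"
  shows "inj_on (cycle_edge s) {1..s}"
proof (rule inj_onI)
  fix i j assume "i \<in> {1..s}" "j \<in> {1..s}" "cycle_edge s i = cycle_edge s j"
  thus "i = j"
    using assms by (cases "i = s"; cases "j = s") (auto simp: cycle_edge_def doubleton_eq_iff)
qed

lemma card_cycle_edge: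
  assumes "s \<ge> 2" and "i \<in> {1..s}"
  shows "card (cycle_edge s i) = 2"
  using assms by (cases "i = s") (auto simp: cycle_edge_def)

text \<open>Going round the cycle, every edge is traversed from its smaller to its larger end,
  except the closing edge, which runs from \<open>s\<close> to 1. Its sign is therefore -1, and the
  signed edges sum to a closed walk with zero boundary.\<close>

lemma cycle_graph_oriented_incidence:
  assumes s: "s \<ge> 3"
  shows "oriented_incidence ((\<lambda>v. {v}) ` {1..s}) (snd (cycle_graph s)) incidence
     (\<lambda>e. if e = cycle_edge s s then -1 else 1)"
proof -
  let ?E = "cycle_edge s" and ?I = "{1..s}" and ?n = "\<lambda>i. i mod s + 1"
  let ?\<epsilon> = "\<lambda>e. if e = ?E s then -1 else 1 :: int"
  have E: "snd (cycle_graph s) = ?E ` ?I"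
    using s by (intro cycle_graph_edges) auto
  have inj: "inj_on ?E ?I"
    by (rule inj_on_cycle_edge[OF s])
  have bij: "bij_betw ?n ?I ?I"
    using s by (intro bij_betw_cycle_successor) auto
  have abs: "\<bar>incidence {v} (?E i)\<bar> = of_bool (v = i \<or> v = ?n i)" if "i \<in> ?I" for v i
    using abs_incidence[of "?E i" "{v}"] card_cycle_edge[of s i] that s
    by (simp add: cycle_edge_def)
  have nz: "incidence {v} (?E i) \<noteq> 0 \<longleftrightarrow> v = i \<or> v = ?n i" if "i \<in> ?I" for v i
    using abs[OF that, of v] by (auto simp: of_bool_def split: if_splits)
  have "incidence {v} (?E i) \<in> {-1, 0, 1}" if "i \<in> ?I" for v i
    using abs[OF that, of v] by (auto simp: abs_if of_bool_def split: if_splits)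
  moreover have "card {c \<in> ?E ` ?I. incidence {v} c \<noteq> 0} = 2" if v: "v \<in> ?I" for v
  proof -
    have "v \<in> ?n ` ?I"
      using bij v by (simp only: bij_betw_imp_surj_on)
    \<comment> \<open>\<open>u\<close> is the predecessor of \<open>v\<close>; the two edges at
      \<open>v\<close> are those that start at \<open>u\<close> and at \<open>v\<close>.\<close>
    then obtain u where u: "u \<in> ?I" "?n u = v"
      by blast
    have "u \<noteq> v"
      using u s by (cases "u = s") auto
    have "v = ?n i \<longleftrightarrow> i = u" if "i \<in> ?I" for i
      using inj_on_eq_iff[OF bij_betw_imp_inj_on[OF bij] that u(1)] u(2) by metis
    hence "{i \<in> ?I. v = i \<or> v = ?n i} = {u, v}"
      using u(1) v by blast
    moreover have "{c \<in> ?E ` ?I. incidence {v} c \<noteq> 0} = ?E ` {i \<in> ?I. v = i \<or> v = ?n i}"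
      using nz by blast
    ultimately have "{c \<in> ?E ` ?I. incidence {v} c \<noteq> 0} = ?E ` {u, v}"
      by (simp only:)
    moreover have "inj_on ?E {u, v}"
      using inj by (rule inj_on_subset) (use u(1) v in simp)
    ultimately show ?thesis
      using \<open>u \<noteq> v\<close> card_image[of ?E "{u, v}"] by simp
  qed
  moreover have "(\<Sum>c\<in>?E ` ?I. ?\<epsilon> c * incidence {v} c) = 0" for v
  proof -
    have h: "?\<epsilon> (?E i) * incidence {v} (?E i) = of_bool (v = ?n i) - of_bool (v = i)" if i: "i \<in> ?I" for i
    proof (cases "i = s")
      case True
      moreover have "?E s = {1, s}"
        by (auto simp: cycle_edge_def)
      moreover have "incidence {v} {1, s} = of_bool (v = s) - of_bool (v = 1)"
        using s by (intro incidence_vertex) auto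
      ultimately show ?thesis by simp
    next
      case False
      hence "?E i \<noteq> ?E s"
        using inj_on_eq_iff[OF inj i, of s] s by simp
      moreover have "?E i = {i, i + 1}" "?n i = i + 1"
        using False i by (auto simp: cycle_edge_def)
      moreover have "incidence {v} {i, i + 1} = of_bool (v = i + 1) - of_bool (v = i)"
        by (intro incidence_vertex) auto
      ultimately show ?thesis by simp
    qed
    have "(\<Sum>c\<in>?E ` ?I. ?\<epsilon> c * incidence {v} c) = (\<Sum>i\<in>?I. ?\<epsilon> (?E i) * incidence {v} (?E i))"
      by (simp only: sum.reindex[OF inj] comp_def)
    also have "\<dots> = (\<Sum>i\<in>?I. of_bool (v = ?n i) - of_bool (v = i))"
      by (intro sum.cong refl h)
    also have "\<dots> = (\<Sum>i\<in>?I. of_bool (v = ?n i)) - (\<Sum>i\<in>?I. of_bool (v = i))"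
      by (rule sum_subtractf)
    \<comment> \<open>Each vertex is entered as often as it is left, since the successor map
      permutes the vertices.\<close>
    also have "(\<Sum>i\<in>?I. of_bool (v = ?n i) :: int) = (\<Sum>i\<in>?I. of_bool (v = i))"
      by (rule sum.reindex_bij_betw[OF bij])
    finally show ?thesis by simp
  qed
  moreover have "(\<lambda>c c'. c \<in> ?E ` ?I \<and> c' \<in> ?E ` ?I \<and>
      (\<exists>r\<in>(\<lambda>v. {v}) ` ?I. incidence r c \<noteq> 0 \<and> incidence r c' \<noteq> 0))\<^sup>*\<^sup>* (?E i) (?E j)"
    (is "?R\<^sup>*\<^sup>* _ _") if ij: "i \<in> ?I" "j \<in> ?I" for i j
  proof -
    \<comment> \<open>All edges are reached from the first one by moving upwards; symmetry of the
      relation then connects any two.\<close>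
    have up: "?R\<^sup>*\<^sup>* (?E 1) (?E (Suc k))" if "k < s" for k
      using that
    proof (induction k)
      case 0 thus ?case by simp
    next
      case (Suc k)
      have "?R\<^sup>*\<^sup>* (?E 1) (?E (Suc k))"
        using Suc by simp
      moreover have "?R (?E (Suc k)) (?E (Suc (Suc k)))"
        using Suc.prems nz[of "Suc k" "Suc (Suc k)"] nz[of "Suc (Suc k)" "Suc (Suc k)"] by auto
      ultimately show ?case
        by (rule rtranclp.rtrancl_into_rtrancl)
    qed
    have "symp ?R\<^sup>*\<^sup>*"
      by (intro symp_rtranclp sympI) blast
    moreover have "?R\<^sup>*\<^sup>* (?E 1) (?E i)" "?R\<^sup>*\<^sup>* (?E 1) (?E j)"
      using up[of "i - 1"] up[of "j - 1"] ij by auto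
    ultimately show ?thesis
      by (rule rtranclp_trans[OF sympD[of "?R\<^sup>*\<^sup>*"]])
  qed
  ultimately show ?thesis
    unfolding oriented_incidence_def E by auto
qed

section \<open>Closed pseudomanifolds\<close>

locale closed_pseudomanifold =
  fixes n :: nat and d :: int and \<Delta> :: "nat set set"
  assumes dim_pos: "d \<ge> 1"
    and cplx: "simplicial_complex n \<Delta>"
    and pm: "pseudomanifold d \<Delta>"
    and closed: "without_boundary \<Delta>"
begin

section \<open>Faces, ridges and facets\<close>

lemma complex_subset: "\<Delta> \<subseteq> Pow {1..n}" and complex_nonempty: "\<Delta> \<noteq> {}"
  using cplx unfolding simplicial_complex_def by blast+

lemma down_closed: "\<sigma> \<in> \<Delta> \<Longrightarrow> \<tau> \<subseteq> \<sigma> \<Longrightarrow> \<tau> \<in> \<Delta>"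
  using cplx unfolding simplicial_complex_def by blast

lemma finite_complex: "finite \<Delta>"
  using complex_subset by (rule finite_subset) simp

lemma finite_face: "\<sigma> \<in> \<Delta> \<Longrightarrow> finite \<sigma>"
  using complex_subset finite_subset by blast

lemma complex_dim_eq: "complex_dim \<Delta> = d"
  using pm by (simp add: pseudomanifold_def)

lemma face_dim_le: "\<sigma> \<in> \<Delta> \<Longrightarrow> face_dim \<sigma> \<le> d"
  using finite_complex complex_dim_eq by (auto simp: complex_dim_def)

lemma facets_eq: "facets \<Delta> = faces \<Delta> d"
proof
  show "facets \<Delta> \<subseteq> faces \<Delta> d"
    using pm by (auto simp: pseudomanifold_def pure_def faces_def facets_def)
  show "faces \<Delta> d \<subseteq> facets \<Delta>"
  proof
    fix F assume F: "F \<in> faces \<Delta> d"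
    have "\<sigma> = F" if "\<sigma> \<in> \<Delta>" "F \<subseteq> \<sigma>" for \<sigma>
    proof -
      have "card \<sigma> \<le> card F"
        using F face_dim_le[OF that(1)] by (auto simp: faces_def face_dim_def)
      thus ?thesis
        using card_seteq[OF finite_face[OF that(1)] that(2)] by simp
    qed
    thus "F \<in> facets \<Delta>" using F by (auto simp: facets_def faces_def)
  qed
qed

lemma card_facet: "F \<in> faces \<Delta> d \<Longrightarrow> card F = nat d + 1"
  using dim_pos by (auto simp: faces_def face_dim_def)

lemma card_ridge: "\<tau> \<in> faces \<Delta> (d - 1) \<Longrightarrow> card \<tau> = nat d"
  using dim_pos by (auto simp: faces_def face_dim_def)

lemma finite_faces [simp]: "finite (faces \<Delta> j)"
  using finite_complex by (simp add: faces_def)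

lemma facet_minus_vertex: "F \<in> faces \<Delta> d \<Longrightarrow> x \<in> F \<Longrightarrow> F - {x} \<in> faces \<Delta> (d - 1)"
  using down_closed[of F "F - {x}"] finite_face[of F] card_Suc_Diff1[of F x]
  by (auto simp: faces_def face_dim_def)

lemma card_cofaces: "\<tau> \<in> faces \<Delta> (d - 1) \<Longrightarrow> card {F \<in> faces \<Delta> d. \<tau> \<subseteq> F} = 2"
  using closed by (simp add: without_boundary_def complex_dim_eq facets_eq)

lemma abs_incidence_ridge:
  assumes "\<tau> \<in> faces \<Delta> (d - 1)" and "F \<in> faces \<Delta> d"
  shows "\<bar>incidence \<tau> F\<bar> = of_bool (\<tau> \<subseteq> F)"
  using assms card_facet[of F] card_ridge[of \<tau>] finite_face[of F]
  by (intro abs_incidence) (auto simp: faces_def)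

lemma incidence_ridge_nonzero:
  assumes "\<tau> \<in> faces \<Delta> (d - 1)" and "F \<in> faces \<Delta> d"
  shows "incidence \<tau> F \<noteq> 0 \<longleftrightarrow> \<tau> \<subseteq> F"
  using abs_incidence_ridge[OF assms] by (auto simp: of_bool_def split: if_splits)

lemma share_ridge_iff:
  "share_ridge \<Delta> F F' \<longleftrightarrow> F \<in> faces \<Delta> d \<and> F' \<in> faces \<Delta> d \<and> F \<noteq> F' \<and>
     (\<exists>\<tau>\<in>faces \<Delta> (d - 1). \<tau> \<subseteq> F \<and> \<tau> \<subseteq> F')"
  by (simp add: share_ridge_def complex_dim_eq facets_eq)

lemma share_ridge_connected:
  "F \<in> faces \<Delta> d \<Longrightarrow> F' \<in> faces \<Delta> d \<Longrightarrow> (share_ridge \<Delta>)\<^sup>*\<^sup>* F F'"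
  using pm by (simp add: pseudomanifold_def facets_eq)

lemma facets_nonempty: "faces \<Delta> d \<noteq> {}"
proof -
  have "Max (face_dim ` \<Delta>) \<in> face_dim ` \<Delta>"
    using finite_complex complex_nonempty by (intro Max_in) auto
  thus ?thesis using complex_dim_eq by (auto simp: complex_dim_def faces_def)
qed

text \<open>Since \<open>d \<ge> 1\<close>, a facet \<open>F\<close> has two distinct vertices
  \<open>x\<close> and \<open>y\<close>. A second facet lies across each of the ridges
  \<open>F - {x}\<close> and \<open>F - {y}\<close>, and the two differ because a facet containing
  both ridges contains \<open>F\<close>. This makes \<open>cycle_graph s\<close> a genuine
  cycle.\<close>

lemma three_facets: "card (faces \<Delta> d) \<ge> 3"
proof -
  obtain F where F: "F \<in> faces \<Delta> d" using facets_nonempty by blast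
  have "finite F" using F by (simp add: faces_def finite_face)
  moreover have "\<not> card F \<le> Suc 0" using card_facet[OF F] dim_pos by auto
  ultimately obtain x y where xy: "x \<in> F" "y \<in> F" "x \<noteq> y"
    by (auto simp: card_le_Suc0_iff_eq)
  have other: "\<exists>F'\<in>faces \<Delta> d. F' \<noteq> F \<and> F - {z} \<subseteq> F'" if "z \<in> F" for z
  proof (rule ccontr)
    assume "\<not> ?thesis"
    hence "{F' \<in> faces \<Delta> d. F - {z} \<subseteq> F'} \<subseteq> {F}" by auto
    hence "card {F' \<in> faces \<Delta> d. F - {z} \<subseteq> F'} \<le> card {F}" by (intro card_mono) auto
    thus False using card_cofaces[OF facet_minus_vertex[OF F that]] by simp
  qed
  obtain A where A: "A \<in> faces \<Delta> d" "A \<noteq> F" "F - {x} \<subseteq> A" using other[OF xy(1)] by blast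
  obtain B where B: "B \<in> faces \<Delta> d" "B \<noteq> F" "F - {y} \<subseteq> B" using other[OF xy(2)] by blast
  have "A \<noteq> B"
  proof
    assume "A = B"
    hence "F \<subseteq> A" using A B xy by blast
    moreover have "F \<in> facets \<Delta>" "A \<in> \<Delta>"
      using A(1) F facets_eq by (simp_all add: faces_def)
    ultimately have "A = F"
      by (simp add: facets_def)
    thus False
      using A(2) by simp
  qed
  hence "card {F, A, B} = 3" using A B by auto
  thus ?thesis using card_mono[of "faces \<Delta> d" "{F, A, B}"] F A B by auto
qed

section \<open>Orientation signs from homology\<close>

text \<open>If zero were the only cycle, the homology group would be a quotient of the trivial
  group, hence finite, whereas the integers are infinite.\<close>

lemma exists_fundamental_cycle:
  assumes "orientable \<Delta>"
  shows "\<exists>z. z \<noteq> 0 \<and> Poly_Mapping.keys z \<subseteq> faces \<Delta> d \<and> frag_extend simplex_boundary z = 0"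
proof (rule ccontr)
  assume none: "\<not> ?thesis"
  let ?G = "simplicial_chain_group \<Delta> d" and ?B = "simplicial_boundaries \<Delta> d"
  have grp: "group ?G" by (simp add: simplicial_chain_group_def)
  have "simplicial_cycles \<Delta> d \<subseteq> {\<one>\<^bsub>?G\<^esub>}"
    using none by (auto simp: simplicial_cycles_def kernel_def simplicial_chain_group_def)
  hence "carrier (subgroup_generated ?G (simplicial_cycles \<Delta> d)) \<subseteq> generate ?G {\<one>\<^bsub>?G\<^esub>}"
    unfolding carrier_subgroup_generated by (intro group.mono_generate[OF grp]) blast
  also have "\<dots> = {\<one>\<^bsub>?G\<^esub>}" by (rule group.generate_one[OF grp])
  finally have "finite (carrier (subgroup_generated ?G (simplicial_cycles \<Delta> d)))"
    by (rule finite_subset) simp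
  hence "finite (carrier (simplicial_homology \<Delta> d))"
    by (simp add: simplicial_homology_def carrier_FactGroup)
  \<comment> \<open>The constant \<open>integer_group\<close> is polymorphic in its carrier, hence the type annotation.\<close>
  moreover have "eqpoll (carrier (simplicial_homology \<Delta> d)) (carrier (integer_group :: int monoid))"
    using assms unfolding orientable_def complex_dim_eq by (rule iso_imp_eqpoll_carrier)
  hence "eqpoll (carrier (simplicial_homology \<Delta> d)) (UNIV :: int set)"
    by (simp add: integer_group_def)
  hence "finite (carrier (simplicial_homology \<Delta> d)) = finite (UNIV :: int set)"
    by (rule eqpoll_finite_iff)
  ultimately show False
    by (simp add: infinite_UNIV_int)
qed

text \<open>At a ridge the boundary of a cycle has two terms, each a coefficient times a sign, so
  adjacent facets carry coefficients of equal absolute value. Strong connectivity makes this value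
  constant, and it is nonzero for a nonzero cycle. Dividing by it leaves the signs
  \<open>sgn (a F)\<close>.\<close>

lemma orientable_oriented_incidence:
  assumes "orientable \<Delta>"
  shows "\<exists>\<epsilon>. oriented_incidence (faces \<Delta> (d - 1)) (faces \<Delta> d) incidence \<epsilon>"
proof -
  obtain z where z: "z \<noteq> 0" "Poly_Mapping.keys z \<subseteq> faces \<Delta> d" "frag_extend simplex_boundary z = 0"
    using exists_fundamental_cycle[OF assms] by blast
  define a where "a = Poly_Mapping.lookup z"
  have bd: "(\<Sum>F\<in>faces \<Delta> d. a F * incidence \<tau> F) = 0" for \<tau>
  proof -
    have "0 = Poly_Mapping.lookup (frag_extend simplex_boundary z) \<tau>" using z(3) by simp
    also have "\<dots> = (\<Sum>F\<in>Poly_Mapping.keys z. a F * incidence \<tau> F)"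
      by (simp add: frag_extend_def lookup_sum a_def)
    also have "\<dots> = (\<Sum>F\<in>faces \<Delta> d. a F * incidence \<tau> F)"
      using z(2) by (intro sum.mono_neutral_left) (auto simp: a_def in_keys_iff)
    finally show ?thesis by simp
  qed
  have step: "\<bar>a F\<bar> = \<bar>a F'\<bar>" if share: "share_ridge \<Delta> F F'" for F F'
  proof -
    obtain \<tau> where \<tau>: "\<tau> \<in> faces \<Delta> (d - 1)" "\<tau> \<subseteq> F" "\<tau> \<subseteq> F'"
      and F: "F \<in> faces \<Delta> d" "F' \<in> faces \<Delta> d" "F \<noteq> F'"
      using share by (auto simp: share_ridge_iff)
    have eq: "{F \<in> faces \<Delta> d. \<tau> \<subseteq> F} = {F, F'}"
      using F \<tau> card_cofaces[OF \<tau>(1)] by (intro card_subset_eq[symmetric]) auto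
    have "(\<Sum>F\<in>faces \<Delta> d. a F * incidence \<tau> F) = (\<Sum>F\<in>{F, F'}. a F * incidence \<tau> F)"
      using F eq incidence_ridge_nonzero[OF \<tau>(1)] by (intro sum.mono_neutral_right) auto
    hence "a F * incidence \<tau> F = - (a F' * incidence \<tau> F')"
      using F bd[of \<tau>] by simp
    hence "\<bar>a F\<bar> * \<bar>incidence \<tau> F\<bar> = \<bar>a F'\<bar> * \<bar>incidence \<tau> F'\<bar>"
      by (metis abs_minus_cancel abs_mult)
    thus ?thesis
      using abs_incidence_ridge[OF \<tau>(1)] F \<tau> by simp
  qed
  have const: "\<bar>a F\<bar> = \<bar>a F'\<bar>" if "F \<in> faces \<Delta> d" "F' \<in> faces \<Delta> d" for F F'
    using share_ridge_connected[OF that] by induction (auto dest: step)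
  have "Poly_Mapping.keys z \<noteq> {}"
    using z(1) by simp
  then obtain F0 where "F0 \<in> Poly_Mapping.keys z"
    by blast
  hence F0: "F0 \<in> faces \<Delta> d" "a F0 \<noteq> 0"
    using z(2) unfolding a_def by (auto simp: in_keys_iff)
  have a_eq: "a F = \<bar>a F0\<bar> * sgn (a F)" if "F \<in> faces \<Delta> d" for F
    using const[OF F0(1) that] by (simp add: abs_mult_sgn)
  have sgn0: "sgn (a F) \<in> {-1, 1}" if "F \<in> faces \<Delta> d" for F
    using const[OF F0(1) that] F0(2) by (auto simp: sgn_if)
  have "(\<Sum>F\<in>faces \<Delta> d. sgn (a F) * incidence \<tau> F) = 0" for \<tau>
  proof -
    have "0 = (\<Sum>F\<in>faces \<Delta> d. \<bar>a F0\<bar> * sgn (a F) * incidence \<tau> F)"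
      unfolding bd[of \<tau>, symmetric] by (intro sum.cong refl) (simp only: a_eq[symmetric])
    also have "\<dots> = \<bar>a F0\<bar> * (\<Sum>F\<in>faces \<Delta> d. sgn (a F) * incidence \<tau> F)"
      by (simp add: sum_distrib_left mult.assoc)
    finally show ?thesis using F0(2) by simp
  qed
  moreover have "card {F \<in> faces \<Delta> d. incidence \<tau> F \<noteq> 0} = 2" if "\<tau> \<in> faces \<Delta> (d - 1)" for \<tau>
  proof -
    have "{F \<in> faces \<Delta> d. incidence \<tau> F \<noteq> 0} = {F \<in> faces \<Delta> d. \<tau> \<subseteq> F}"
      using incidence_ridge_nonzero[OF that] by blast
    thus ?thesis using card_cofaces[OF that] by simp
  qed
  moreover have "incidence \<tau> F \<in> {-1, 0, 1}" if "\<tau> \<in> faces \<Delta> (d - 1)" "F \<in> faces \<Delta> d" for \<tau> F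
    using abs_incidence_ridge[OF that] by (auto simp: abs_if of_bool_def split: if_splits)
  moreover have "(\<lambda>F F'. F \<in> faces \<Delta> d \<and> F' \<in> faces \<Delta> d \<and>
      (\<exists>\<tau>\<in>faces \<Delta> (d - 1). incidence \<tau> F \<noteq> 0 \<and> incidence \<tau> F' \<noteq> 0))\<^sup>*\<^sup>* F F'"
    if "F \<in> faces \<Delta> d" "F' \<in> faces \<Delta> d" for F F'
    using share_ridge_connected[OF that]
    by (rule rtranclp_mono[THEN predicate2D, rotated]) (auto simp: share_ridge_iff incidence_ridge_nonzero)
  ultimately show ?thesis
    unfolding oriented_incidence_def using sgn0 by (intro exI[of _ "\<lambda>F. sgn (a F)"]) auto
qed

lemma face_list_props: "set (face_list \<Delta> j) = faces \<Delta> j" "distinct (face_list \<Delta> j)"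
  using face_list[OF finite_complex] finite_face by blast+

section \<open>The two equivalences\<close>

lemma lower_polytope_equivalent_cycle:
  assumes "orientable \<Delta>" and s: "s = card (faces \<Delta> d)"
  shows "unimodularly_equivalent (lower_polytope \<Delta>) (symmetric_edge_polytope (cycle_graph s))"
proof -
  let ?C = "graph_complex (cycle_graph s)"
  obtain \<epsilon> where o: "oriented_incidence (faces \<Delta> (d - 1)) (faces \<Delta> d) incidence \<epsilon>"
    using orientable_oriented_incidence assms(1) by blast
  have s3: "s \<ge> 3" using s three_facets by simp
  have E: "snd (cycle_graph s) = cycle_edge s ` {1..s}" using s3 by (intro cycle_graph_edges) auto
  have V: "fst (cycle_graph s) = {1..s}" by (simp add: cycle_graph_def)
  have c2: "\<forall>e\<in>snd (cycle_graph s). card e = 2"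
    using E card_cycle_edge[of s] s3 by auto
  have "finite (fst (cycle_graph s))" "finite (snd (cycle_graph s))"
    unfolding V E by simp_all
  note fin = graph_complex_finite[OF this c2]
  note fl = face_list[OF fin] and gf = graph_complex_faces[OF c2]
  have "card (snd (cycle_graph s)) = s"
    unfolding E using card_image[OF inj_on_cycle_edge[OF s3]] by simp
  \<comment> \<open>The number of columns is the only link between the two matrices:
    \<open>s\<close> facets on one side, \<open>s\<close> edges on the other.\<close>
  hence len: "length (face_list \<Delta> d) = length (face_list ?C 1)"
    using s fl[of 1] gf face_list_props[of d] by (metis distinct_card)
  have "oriented_incidence (set (face_list ?C 0)) (set (face_list ?C 1)) incidence
      (\<lambda>e. if e = cycle_edge s s then -1 else 1)"
    using cycle_graph_oriented_incidence[OF s3] by (simp add: fl gf V)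
  from unimodularly_equivalent_oriented_incidence[OF face_list_props(2) fl(2) face_list_props(2) fl(2) len _ this]
  show ?thesis
    using o by (simp add: lower_polytope_def symmetric_edge_polytope_def complex_dim_eq boundary_mat_eq face_list_props)
qed

lemma ridge_cofaces:
  assumes "\<tau> \<in> faces \<Delta> (d - 1)"
  obtains F F' where "F \<in> faces \<Delta> d" "F' \<in> faces \<Delta> d" "F \<noteq> F'" "\<tau> \<subseteq> F" "\<tau> \<subseteq> F'"
    "{F \<in> faces \<Delta> d. \<tau> \<subseteq> F} = {F, F'}"
proof -
  obtain F F' where eq: "{F \<in> faces \<Delta> d. \<tau> \<subseteq> F} = {F, F'}" "F \<noteq> F'"
    using iffD1[OF card_2_iff card_cofaces[OF assms]] by metis
  have "F \<in> {F \<in> faces \<Delta> d. \<tau> \<subseteq> F}" "F' \<in> {F \<in> faces \<Delta> d. \<tau> \<subseteq> F}"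
    unfolding eq(1) by simp_all
  hence "F \<in> faces \<Delta> d" "F' \<in> faces \<Delta> d" "\<tau> \<subseteq> F" "\<tau> \<subseteq> F'"
    by blast+
  thus ?thesis
    using that eq by metis
qed

text \<open>The labels decide the orientation of an edge in the relabelled graph, so the two facets
  at a ridge are named in the order of their labels.\<close>

lemma ridge_cofaces_ordered:
  fixes \<phi> :: "nat set \<Rightarrow> nat"
  assumes \<tau>: "\<tau> \<in> faces \<Delta> (d - 1)" and inj: "inj_on \<phi> (faces \<Delta> d)"
  obtains F F' where "F \<in> faces \<Delta> d" "F' \<in> faces \<Delta> d" "\<phi> F < \<phi> F'"
    "{F \<in> faces \<Delta> d. \<tau> \<subseteq> F} = {F, F'}"
proof -
  obtain F F' where F: "F \<in> faces \<Delta> d" "F' \<in> faces \<Delta> d" "F \<noteq> F'"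
    and eq: "{F \<in> faces \<Delta> d. \<tau> \<subseteq> F} = {F, F'}"
    using \<tau> by (rule ridge_cofaces)
  have "\<phi> F \<noteq> \<phi> F'"
    using inj_on_eq_iff[OF inj F(1,2)] F(3) by simp
  then consider "\<phi> F < \<phi> F'" | "\<phi> F' < \<phi> F"
    by linarith
  thus ?thesis
  proof cases
    case 1
    show ?thesis by (rule that[OF F(1,2) 1 eq])
  next
    case 2
    show ?thesis by (rule that[OF F(2,1) 2]) (unfold eq, rule insert_commute)
  qed
qed

text \<open>Two distinct facets meet in at most \<open>d\<close> vertices, so a ridge common to both
  equals their intersection. Adjacent facets thus share only one ridge, and the simple graph merges
  no ridges into one edge.\<close>

lemma bij_betw_ridges_edges:
  "bij_betw (\<lambda>\<tau>. {F \<in> faces \<Delta> d. \<tau> \<subseteq> F}) (faces \<Delta> (d - 1)) (snd (facet_ridge_graph \<Delta>))"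
proof -
  let ?c = "\<lambda>\<tau>. {F \<in> faces \<Delta> d. \<tau> \<subseteq> F}"
  show ?thesis
  proof (rule bij_betwI')
    fix \<tau> \<tau>' assume t: "\<tau> \<in> faces \<Delta> (d - 1)" "\<tau>' \<in> faces \<Delta> (d - 1)"
    show "(?c \<tau> = ?c \<tau>') = (\<tau> = \<tau>')"
    proof
      assume eq: "?c \<tau> = ?c \<tau>'"
      obtain F F' where F: "F \<in> faces \<Delta> d" "F' \<in> faces \<Delta> d" "F \<noteq> F'" "\<tau> \<subseteq> F" "\<tau> \<subseteq> F'" "?c \<tau> = {F, F'}"
        using t(1) by (rule ridge_cofaces)
      have "F \<in> ?c \<tau>'" "F' \<in> ?c \<tau>'"
        unfolding eq[symmetric] F(6) by simp_all
      hence sub: "\<tau>' \<subseteq> F \<inter> F'" by blast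
      have fin: "finite F" using F(1) finite_face by (simp add: faces_def)
      have "F \<inter> F' \<noteq> F"
      proof
        assume "F \<inter> F' = F"
        hence "F \<subseteq> F'" by blast
        moreover have "finite F'" using F(2) finite_face by (simp add: faces_def)
        ultimately show False
          using F(3) card_subset_eq card_facet[OF F(1)] card_facet[OF F(2)] by metis
      qed
      hence "card (F \<inter> F') < card F" using fin by (intro psubset_card_mono) auto
      hence "card (F \<inter> F') \<le> nat d" using card_facet[OF F(1)] by simp
      hence "\<tau> = F \<inter> F'" "\<tau>' = F \<inter> F'"
        using F(4,5) sub fin card_ridge[OF t(1)] card_ridge[OF t(2)] card_seteq[of "F \<inter> F'"] by simp_all
      thus "\<tau> = \<tau>'" by simp
    qed simp
  next
    fix \<tau> assume \<tau>: "\<tau> \<in> faces \<Delta> (d - 1)"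
    obtain F F' where F: "F \<in> faces \<Delta> d" "F' \<in> faces \<Delta> d" "F \<noteq> F'" "\<tau> \<subseteq> F" "\<tau> \<subseteq> F'" "?c \<tau> = {F, F'}"
      using \<tau> by (rule ridge_cofaces)
    have "share_ridge \<Delta> F F'"
      using F(1-5) \<tau> by (auto simp: share_ridge_iff)
    thus "?c \<tau> \<in> snd (facet_ridge_graph \<Delta>)"
      unfolding F(6) facet_ridge_graph_def by auto
  next
    fix e assume "e \<in> snd (facet_ridge_graph \<Delta>)"
    then obtain F F' \<tau> where e: "e = {F, F'}" "F \<in> faces \<Delta> d" "F' \<in> faces \<Delta> d" "F \<noteq> F'"
        "\<tau> \<in> faces \<Delta> (d - 1)" "\<tau> \<subseteq> F" "\<tau> \<subseteq> F'"
      by (auto simp: facet_ridge_graph_def share_ridge_iff)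
    hence "{F, F'} = ?c \<tau>"
      using card_cofaces[of \<tau>] by (intro card_subset_eq) auto
    thus "\<exists>\<tau>\<in>faces \<Delta> (d - 1). e = ?c \<tau>" using e by auto
  qed
qed

text \<open>The facets index the rows and the ridges the columns. Up to a sign per row and a sign
  per column, this is already the incidence matrix of the graph, so the transition matrices are
  signed permutations.\<close>

lemma upper_polytope_equivalent_facet_ridge_graph:
  assumes "orientable \<Delta>" and \<phi>: "bij_betw \<phi> (facets \<Delta>) {1..card (faces \<Delta> d)}"
  shows "unimodularly_equivalent (upper_polytope \<Delta>)
    (symmetric_edge_polytope (relabel \<phi> (facet_ridge_graph \<Delta>)))"
proof -
  let ?D = "faces \<Delta> d" and ?R = "faces \<Delta> (d - 1)"
  define G where "G = relabel \<phi> (facet_ridge_graph \<Delta>)"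
  define \<pi> where "\<pi> = (\<lambda>\<tau>. \<phi> ` {F \<in> ?D. \<tau> \<subseteq> F})"
  obtain \<epsilon> where o: "oriented_incidence ?R ?D incidence \<epsilon>"
    using orientable_oriented_incidence assms(1) by blast
  have \<epsilon>: "\<epsilon> F \<in> {-1, 1}" if "F \<in> ?D" for F
    using o that by (simp add: oriented_incidence_def)
  have inj: "inj_on \<phi> ?D" using \<phi> by (simp add: bij_betw_def facets_eq)
  have V: "fst G = \<phi> ` ?D" and E: "snd G = (`) \<phi> ` snd (facet_ridge_graph \<Delta>)"
    by (simp_all add: G_def relabel_def facet_ridge_graph_def facets_eq)
  have "snd (facet_ridge_graph \<Delta>) \<subseteq> Pow ?D"
    by (auto simp: facet_ridge_graph_def share_ridge_iff)
  hence "inj_on ((`) \<phi>) (snd (facet_ridge_graph \<Delta>))"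
    by (rule inj_on_subset[OF inj_on_image_Pow[OF inj]])
  hence "bij_betw ((`) \<phi>) (snd (facet_ridge_graph \<Delta>)) (snd G)"
    by (simp add: bij_betw_def E)
  from bij_betw_trans[OF bij_betw_ridges_edges this]
  have \<pi>: "bij_betw \<pi> ?R (snd G)" by (simp add: \<pi>_def comp_def)
  have card_\<pi>: "card (\<pi> \<tau>) = 2" if \<tau>: "\<tau> \<in> ?R" for \<tau>
    unfolding \<pi>_def using card_image[OF inj_on_subset[OF inj], of "{F \<in> ?D. \<tau> \<subseteq> F}"] card_cofaces[OF \<tau>]
    by auto
  have c2: "\<forall>e\<in>snd G. card e = 2"
    unfolding bij_betw_imp_surj_on[OF \<pi>, symmetric] using card_\<pi> by simp
  have "finite (fst G)" "finite (snd G)"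
    using V bij_betw_finite[OF \<pi>] by simp_all
  note fin = graph_complex_finite[OF this c2]
  note fl = face_list[OF fin] and gf = graph_complex_faces[OF c2]
  \<comment> \<open>The sign of a column compares two orientations of the same edge: the one induced
    by \<open>\<epsilon>\<close> and the one from the smaller to the larger label.\<close>
  have "\<exists>\<delta>\<in>{-1, 1}. \<forall>F\<in>?D. \<delta> * incidence \<tau> F = \<epsilon> F * incidence {\<phi> F} (\<pi> \<tau>)" if \<tau>: "\<tau> \<in> ?R" for \<tau>
  proof -
    obtain F F' where F: "F \<in> ?D" "F' \<in> ?D" "\<phi> F < \<phi> F'" and eq: "{F \<in> ?D. \<tau> \<subseteq> F} = {F, F'}"
      using \<tau> inj by (rule ridge_cofaces_ordered)
    have \<pi>\<tau>: "\<pi> \<tau> = {\<phi> F, \<phi> F'}" unfolding \<pi>_def eq by simp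
    have sub: "H \<in> ?D \<and> \<tau> \<subseteq> H \<longleftrightarrow> H = F \<or> H = F'" for H using eq by (simp add: set_eq_iff)
    have "F \<noteq> F'" using F(3) by auto
    have nz: "incidence \<tau> F \<noteq> 0" "incidence \<tau> F' \<noteq> 0"
      using sub[of F] sub[of F'] incidence_ridge_nonzero[OF \<tau>] F(1,2) by simp_all
    have opp: "\<epsilon> F' * incidence \<tau> F' = - (\<epsilon> F * incidence \<tau> F)"
      by (rule oriented_incidence_opposite(1)[OF o \<tau> F(1,2) \<open>F \<noteq> F'\<close> nz])
    have signs: "\<epsilon> F \<in> {-1, 1}" "\<epsilon> F' \<in> {-1, 1}" "incidence \<tau> F \<in> {-1, 1}" "incidence \<tau> F' \<in> {-1, 1}"
      using \<epsilon> abs_incidence_ridge[OF \<tau> F(1)] abs_incidence_ridge[OF \<tau> F(2)] sub[of F] sub[of F'] F(1,2)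
      by auto
    \<comment> \<open>The witness is read off at \<open>F'\<close>, the end with the larger label,
      where the edge vector has entry +1. Cancellation along the ridge makes it correct at
      \<open>F\<close> too.\<close>
    have "\<epsilon> F' * incidence \<tau> F' * incidence \<tau> H = \<epsilon> H * incidence {\<phi> H} (\<pi> \<tau>)" if H: "H \<in> ?D" for H
    proof -
      have inc: "incidence {\<phi> H} (\<pi> \<tau>) = of_bool (H = F') - of_bool (H = F)"
        unfolding \<pi>\<tau> incidence_vertex[OF F(3)]
        using inj_on_eq_iff[OF inj H F(1)] inj_on_eq_iff[OF inj H F(2)] by simp
      consider "H = F" | "H = F'" | "H \<noteq> F" "H \<noteq> F'" by blast
      thus ?thesis
      proof cases
        case 1
        thus ?thesis using \<open>F \<noteq> F'\<close> signs unfolding inc opp by auto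
      next
        case 2
        thus ?thesis using \<open>F \<noteq> F'\<close> signs unfolding inc by auto
      next
        case 3
        hence "incidence \<tau> H = 0" using H sub[of H] incidence_ridge_nonzero[OF \<tau> H] by blast
        thus ?thesis using 3 unfolding inc by simp
      qed
    qed
    moreover have "\<epsilon> F' * incidence \<tau> F' \<in> {-1, 1}" using signs by auto
    ultimately show ?thesis by blast
  qed
  then obtain \<delta> where \<delta>: "\<And>\<tau>. \<tau> \<in> ?R \<Longrightarrow> \<delta> \<tau> \<in> {-1, 1}"
    "\<And>\<tau> F. \<tau> \<in> ?R \<Longrightarrow> F \<in> ?D \<Longrightarrow> \<delta> \<tau> * incidence \<tau> F = \<epsilon> F * incidence {\<phi> F} (\<pi> \<tau>)"
    by metis
  have delta_sum: "(\<Sum>t\<in>T. (if t = u then k else 0) * h t) = k * h u"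
    if "finite T" "u \<in> T" for T :: "nat set set" and u and k :: int and h
    using that by (simp add: if_distrib[of "\<lambda>x. x * _"] cong: if_cong)
  have "unimodularly_equivalent
      (symmetric_polytope (list_mat (face_list \<Delta> d) (face_list \<Delta> (d - 1)) (\<lambda>F \<tau>. incidence \<tau> F)))
      (symmetric_polytope (list_mat (face_list (graph_complex G) 0) (face_list (graph_complex G) 1) incidence))"
  proof (rule unimodularly_equivalent_list_mat[where \<pi> = \<pi> and \<delta> = \<delta>])
    fix F assume "F \<in> set (face_list \<Delta> d)"
    hence F: "F \<in> ?D" by (simp add: face_list_props)
    \<comment> \<open>Row \<open>F\<close> is \<open>\<epsilon> F\<close> times the row of the
      vertex labelled \<open>\<phi> F\<close>, so a single coefficient is nonzero.\<close>
    show "\<exists>x. \<forall>c\<in>set (face_list \<Delta> (d - 1)). \<delta> c * incidence c F =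
        (\<Sum>t\<in>set (face_list (graph_complex G) 0). x t * incidence t (\<pi> c))"
      using F \<delta>(2) unfolding face_list_props fl gf V
      by (intro exI[of _ "\<lambda>t. if t = {\<phi> F} then \<epsilon> F else 0"]) (subst delta_sum; simp)
  next
    fix t assume "t \<in> set (face_list (graph_complex G) 0)"
    then obtain F where F: "F \<in> ?D" "t = {\<phi> F}" by (auto simp: fl gf V)
    have "\<epsilon> F * \<epsilon> F = 1" using \<epsilon>[OF F(1)] by auto
    hence "incidence t (\<pi> \<tau>) = \<epsilon> F * (\<delta> \<tau> * incidence \<tau> F)" if "\<tau> \<in> ?R" for \<tau>
      using \<delta>(2)[OF that F(1)] F(2) by (simp add: mult.assoc[symmetric])
    thus "\<exists>y. \<forall>c\<in>set (face_list \<Delta> (d - 1)). incidence t (\<pi> c) =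
        (\<Sum>r\<in>set (face_list \<Delta> d). y r * (\<delta> c * incidence c r))"
      using F(1) unfolding face_list_props
      by (intro exI[of _ "\<lambda>r. if r = F then \<epsilon> F else 0"]) (subst delta_sum; simp)
  qed (use \<delta>(1) \<pi> in \<open>simp_all add: face_list_props fl gf\<close>)
  thus ?thesis
    by (simp add: upper_polytope_def symmetric_edge_polytope_def complex_dim_eq boundary_mat_eq
        transpose_list_mat G_def)
qed

end

theorem theorem8p3:
  fixes n s :: nat and d :: int and \<Delta> :: "nat set set"
  assumes "d \<ge> 1"
    and "simplicial_complex n \<Delta>"
    and "pseudomanifold d \<Delta>"
    and "without_boundary \<Delta>"
    and "orientable \<Delta>"
    and "s = card (faces \<Delta> d)"
  shows "unimodularly_equivalent (lower_polytope \<Delta>) (symmetric_edge_polytope (cycle_graph s)) \<and>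
    (\<forall>\<phi>. bij_betw \<phi> (facets \<Delta>) {1..s} \<longrightarrow>
      unimodularly_equivalent (upper_polytope \<Delta>)
        (symmetric_edge_polytope (relabel \<phi> (facet_ridge_graph \<Delta>))))"
proof -
  interpret closed_pseudomanifold n d \<Delta>
    using assms by unfold_locales
  show ?thesis
    using assms(5,6) lower_polytope_equivalent_cycle upper_polytope_equivalent_facet_ridge_graph by blast
qed

end
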